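(* Let $G$ be a topological group which is an FC-group. Then every irreducible affine isometric action of $G$ on a Hilbert space $\mathcal H$ is given by a homomorphism $b:G\to\mathcal H$ such that $\mathrm{span}(b(G))$ is dense in $\mathcal H$; that is, the action is $\alpha(g)v=v+b(g)$ with $b$ a (continuous) homomorphism from $G$ to the additive group of $\mathcal H$ whose image spans a dense subspace.
   Context: A group $G$ is an FC-group if every conjugacy class in $G$ is finite. An affine isometric action of $G$ on $\mathcal H$ has the form $\alpha(g)v=\pi(g)v+b(g)$ with $\pi$ a continuous unitary representation and $b:G\to\mathcal H$ continuous with $b(gh)=b(g)+\pi(g)b(h)$. It is irreducible if $\mathcal H$ has no non-empty, closed, proper $\alpha(G)$-invariant affine subspace. *)

theory Defs
  imports "HOL-Analysis.Analysis"
begin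

section \<open>Complex Hilbert spaces\<close>

text \<open>
  A complex Hilbert space is presented as a complete real inner product space (which supplies norm,
  metric and topology) together with a compatible complex structure and a sesquilinear form, linear
  in the first argument, whose real part is the given real inner product.  Every complex Hilbert
  space is of this form, with \<open>inner x y = Re (cinner x y)\<close>; the norm is then the
  usual one, see \<open>cinner_self\<close> below.
\<close>

class complex_vector = real_vector +
  fixes scaleC :: "complex \<Rightarrow> 'a \<Rightarrow> 'a" (infixr "*\<^sub>C" 75)
  assumes scaleC_add_right: "c *\<^sub>C (x + y) = c *\<^sub>C x + c *\<^sub>C y"
    and scaleC_add_left: "(c + d) *\<^sub>C x = c *\<^sub>C x + d *\<^sub>C x"
    and scaleC_scaleC: "c *\<^sub>C d *\<^sub>C x = (c * d) *\<^sub>C x"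
    and scaleC_of_real: "complex_of_real r *\<^sub>C x = r *\<^sub>R x"

global_interpretation complex_vector: vector_space "scaleC :: complex \<Rightarrow> 'a \<Rightarrow> 'a::complex_vector"
  defines cspan = complex_vector.span
proof
  show "1 *\<^sub>C x = x" for x :: 'a
    using scaleC_of_real[of 1 x] by simp
qed (rule scaleC_add_right scaleC_add_left scaleC_scaleC)+

class complex_inner = complex_vector + real_inner +
  fixes cinner :: "'a \<Rightarrow> 'a \<Rightarrow> complex"
  assumes cinner_commute: "cinner x y = cnj (cinner y x)"
    and cinner_add_left: "cinner (x + y) z = cinner x z + cinner y z"
    and cinner_scaleC_left: "cinner (c *\<^sub>C x) y = c * cinner x y"
    and Re_cinner: "Re (cinner x y) = inner x y"

class chilbert_space = complex_inner + complete_space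

lemma cinner_self: "cinner x x = complex_of_real ((norm x)\<^sup>2)"
  for x :: "'a::complex_inner"
proof (rule complex_eqI)
  show "Re (cinner x x) = Re (complex_of_real ((norm x)\<^sup>2))"
    by (simp add: Re_cinner power2_norm_eq_inner)
  show "Im (cinner x x) = Im (complex_of_real ((norm x)\<^sup>2))"
    using arg_cong[OF cinner_commute[of x x], of Im] by simp
qed

instantiation complex :: chilbert_space
begin

definition scaleC_complex :: "complex \<Rightarrow> complex \<Rightarrow> complex"
  where "scaleC_complex c z = c * z"

definition cinner_complex :: "complex \<Rightarrow> complex \<Rightarrow> complex"
  where "cinner_complex z w = z * cnj w"

instance
  by standard
    (simp_all add: scaleC_complex_def cinner_complex_def inner_complex_def scaleR_conv_of_real
      algebra_simps)

end

definition complex_affine :: "'h::complex_vector set \<Rightarrow> bool"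
  where "complex_affine S \<longleftrightarrow>
    (\<forall>x\<in>S. \<forall>y\<in>S. \<forall>c d. c + d = 1 \<longrightarrow> c *\<^sub>C x + d *\<^sub>C y \<in> S)"

section \<open>Affine isometric actions\<close>

text \<open>
  Groups are written additively, following the class \<open>topological_group_add\<close>; this
  class does \<^emph>\<open>not\<close> include commutativity (nor the Hausdorff axiom).
\<close>

definition FC_group :: "'g::group_add itself \<Rightarrow> bool"
  where "FC_group _ \<longleftrightarrow> (\<forall>g::'g. finite {h + g - h | h. True})"

definition unitary :: "('h::complex_inner \<Rightarrow> 'h) \<Rightarrow> bool"
  where "unitary U \<longleftrightarrow> Vector_Spaces.linear scaleC scaleC U \<and> surj U \<and>
    (\<forall>x y. cinner (U x) (U y) = cinner x y)"

text \<open>Continuity of a representation is meant in the strong operator topology.\<close>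

definition unitary_representation :: "('g::topological_group_add \<Rightarrow> 'h::complex_inner \<Rightarrow> 'h) \<Rightarrow> bool"
  where "unitary_representation \<pi> \<longleftrightarrow>
    (\<forall>g. unitary (\<pi> g)) \<and> \<pi> 0 = id \<and> (\<forall>g h. \<pi> (g + h) = \<pi> g \<circ> \<pi> h) \<and>
    (\<forall>v. continuous_on UNIV (\<lambda>g. \<pi> g v))"

definition affine_isometric_action :: "('g::topological_group_add \<Rightarrow> 'h::complex_inner \<Rightarrow> 'h) \<Rightarrow> bool"
  where "affine_isometric_action \<alpha> \<longleftrightarrow> (\<exists>\<pi> b. unitary_representation \<pi> \<and>
    continuous_on UNIV b \<and> (\<forall>g h. b (g + h) = b g + \<pi> g (b h)) \<and>
    (\<forall>g v. \<alpha> g v = \<pi> g v + b g))"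

definition irreducible_action :: "('g \<Rightarrow> 'h::complex_inner \<Rightarrow> 'h) \<Rightarrow> bool"
  where "irreducible_action \<alpha> \<longleftrightarrow>
    \<not> (\<exists>S. S \<noteq> {} \<and> S \<noteq> UNIV \<and> closed S \<and> complex_affine S \<and> (\<forall>g. \<alpha> g ` S \<subseteq> S))"

end

theory Submission
  imports Defs
begin

text \<open>
  Fix \<open>g\<close>, let \<open>C\<close> be its (finite) conjugacy class and put
  \<open>D v = \<Sum>c\<in>C. (v - \<alpha>(c) v) + (v - \<alpha>(-c) v)\<close>. Since \<open>C\<close> is invariant under conjugation,
  \<open>D \<circ> \<alpha>(h) = \<pi>(h) \<circ> D\<close>, and the linear part \<open>N\<close> of \<open>D\<close> is a positive operator commuting with
  \<open>\<pi>(G)\<close>. If \<open>N \<noteq> 0\<close>, let \<open>Q\<close> be a positive multiple of the positive part of \<open>N - \<epsilon>\<close> for a small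
  \<open>\<epsilon> > 0\<close>. As \<open>N\<close> is invertible on the spectral subspace where \<open>N \<ge> \<epsilon>\<close>, the set \<open>{v. Q (D v) = 0}\<close>
  is non-empty; it is a closed invariant affine subspace, and it is proper because \<open>Q N \<noteq> 0\<close>. So
  irreducibility forces \<open>N = 0\<close>, which means \<open>\<pi>(c) = 1\<close> for \<open>c \<in> C\<close>. Hence \<open>\<pi>\<close> is trivial, and
  the closed span of the image of the cocycle is itself an invariant affine subspace.
\<close>

section \<open>Positive parts of operators\<close>

text \<open>
  The iterates \<open>Y\<^sub>0 = 0\<close>, \<open>Y\<^sub>n\<^sub>+\<^sub>1 = (X + Y\<^sub>n\<^sup>2)/2\<close> converge to \<open>1 - sqrt (1 - X)\<close>; the scalar case
  \<open>X = 1\<close> dominates the increments of the general one.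
\<close>

fun sqrt_iterate :: "('a::real_normed_vector \<Rightarrow>\<^sub>L 'a) \<Rightarrow> nat \<Rightarrow> 'a \<Rightarrow>\<^sub>L 'a" where
  "sqrt_iterate X 0 = 0"
| "sqrt_iterate X (Suc n) = (1/2) *\<^sub>R (X + (sqrt_iterate X n o\<^sub>L sqrt_iterate X n))"

fun scalar_iterate :: "nat \<Rightarrow> real" where
  "scalar_iterate 0 = 0"
| "scalar_iterate (Suc n) = (1 + (scalar_iterate n)\<^sup>2) / 2"

lemma scalar_iterate_bounds: "0 \<le> scalar_iterate n" "scalar_iterate n \<le> 1"
proof (induction n)
  case (Suc n)
  { case 1 then show ?case by simp }
  { case 2 then show ?case using Suc by (simp add: power_le_one) }
qed auto

lemma scalar_iterate_convergent: "convergent scalar_iterate"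
proof -
  have "scalar_iterate n \<le> scalar_iterate (Suc n)" for n
    using zero_le_power2[of "1 - scalar_iterate n"] by (simp add: power2_eq_square algebra_simps)
  then have "incseq scalar_iterate"
    by (rule incseq_SucI)
  moreover have "Bseq scalar_iterate"
    by (rule BseqI'[where K = 1]) (simp add: scalar_iterate_bounds)
  ultimately show ?thesis
    using Bseq_mono_convergent by (auto simp: incseq_def)
qed

text \<open>Each iterate is a polynomial in \<open>X\<close>, so whatever commutes with
  \<open>X\<close> commutes with it.\<close>

lemma sqrt_iterate_commute:
  fixes X :: "'a::real_normed_vector \<Rightarrow>\<^sub>L 'a"
  assumes B: "bounded_linear B" and BX: "\<And>v. B (X v) = X (B v)"
  shows "B (sqrt_iterate X n v) = sqrt_iterate X n (B v)"
proof -
  interpret B: bounded_linear B by (fact B)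
  show ?thesis
    by (induction n arbitrary: v)
      (simp_all add: BX B.zero B.add B.scaleR blinfun.bilinear_simps)
qed

lemma sqrt_iterate_commute_self:
  "sqrt_iterate X m (sqrt_iterate X n v) = sqrt_iterate X n (sqrt_iterate X m v)"
  by (intro sqrt_iterate_commute blinfun.bounded_linear_right
      sqrt_iterate_commute[symmetric]) simp

lemma norm_sqrt_iterate:
  assumes "norm X \<le> 1"
  shows "norm (sqrt_iterate X n) \<le> scalar_iterate n"
proof (induction n)
  case (Suc n)
  let ?Y = "sqrt_iterate X n"
  have "norm (?Y o\<^sub>L ?Y) \<le> norm ?Y * norm ?Y"
    by (rule norm_blinfun_compose)
  also have "\<dots> \<le> (scalar_iterate n)\<^sup>2"
    unfolding power2_eq_square by (intro mult_mono Suc scalar_iterate_bounds norm_ge_zero)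
  finally show ?case
    using norm_triangle_ineq[of X "?Y o\<^sub>L ?Y"] assms by simp
qed simp

text \<open>Since iterates commute, the difference of their squares factors as
  \<open>(Z + Y) (Z - Y)\<close>. The scalar recursion factors in the same way, which carries the
  induction.\<close>

lemma norm_sqrt_iterate_diff:
  assumes "norm X \<le> 1"
  shows "norm (sqrt_iterate X (Suc n) - sqrt_iterate X n) \<le> scalar_iterate (Suc n) - scalar_iterate n"
proof (induction n)
  case 0
  then show ?case using assms by simp
next
  case (Suc n)
  define Y Z where "Y = sqrt_iterate X n" and "Z = sqrt_iterate X (Suc n)"
  define y z where "y = scalar_iterate n" and "z = scalar_iterate (Suc n)"
  have comm: "Y (Z v) = Z (Y v)" for v
    unfolding Y_def Z_def by (rule sqrt_iterate_commute_self)
  have "sqrt_iterate X (Suc (Suc n)) - Z = (1/2) *\<^sub>R ((Z + Y) o\<^sub>L (Z - Y))"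
  proof -
    have "sqrt_iterate X (Suc (Suc n)) - Z = (1/2) *\<^sub>R (X + (Z o\<^sub>L Z)) - (1/2) *\<^sub>R (X + (Y o\<^sub>L Y))"
      unfolding Y_def Z_def by simp
    also have "\<dots> = (1/2) *\<^sub>R ((Z + Y) o\<^sub>L (Z - Y))"
      by (rule blinfun_eqI)
        (simp add: blinfun.bilinear_simps comm scaleR_add_right[symmetric] scaleR_diff_right[symmetric])
    finally show ?thesis .
  qed
  then have "norm (sqrt_iterate X (Suc (Suc n)) - Z) \<le> (1/2) * (norm (Z + Y) * norm (Z - Y))"
    using norm_blinfun_compose[of "Z + Y" "Z - Y"] by simp
  also have "\<dots> \<le> (1/2) * ((z + y) * (z - y))"
  proof -
    have "norm (Z + Y) \<le> z + y"
      using norm_triangle_ineq[of Z Y] norm_sqrt_iterate[OF assms, of n]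
        norm_sqrt_iterate[OF assms, of "Suc n"]
      unfolding Y_def Z_def y_def z_def by linarith
    moreover have "norm (Z - Y) \<le> z - y"
      using Suc unfolding Y_def Z_def y_def z_def .
    ultimately show ?thesis
      by (intro mult_left_mono mult_mono) (auto intro: order_trans[OF norm_ge_zero])
  qed
  also have "\<dots> = scalar_iterate (Suc (Suc n)) - z"
    by (simp add: y_def z_def power2_eq_square field_simps)
  finally show ?case
    unfolding Z_def z_def .
qed

text \<open>The increments are summable in norm because the scalar ones dominating them telescope.
  The equation for the limit says that \<open>(1 - Y)^2 = 1 - X\<close>; commutation passes to the
  limit.\<close>

lemma one_minus_sqrt_exists:
  fixes X :: "'a::banach \<Rightarrow>\<^sub>L 'a"
  assumes X: "norm X \<le> 1"
  obtains Y :: "'a \<Rightarrow>\<^sub>L 'a" where "norm Y \<le> 1" "\<And>v. 2 *\<^sub>R Y v = X v + Y (Y v)"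
    "\<And>B v. bounded_linear B \<Longrightarrow> (\<And>u. B (X u) = X (B u)) \<Longrightarrow> B (Y v) = Y (B v)"
proof -
  let ?Y = "sqrt_iterate X"
  have "summable (\<lambda>n. scalar_iterate (Suc n) - scalar_iterate n)"
    using scalar_iterate_convergent telescope_summable unfolding convergent_def by blast
  then have "summable (\<lambda>n. ?Y (Suc n) - ?Y n)"
    by (rule summable_comparison_test'[where N = 0]) (rule norm_sqrt_iterate_diff[OF X])
  then obtain Y where "(\<lambda>n. ?Y (Suc n) - ?Y n) sums Y"
    by (auto simp: summable_def)
  \<comment> \<open>The partial sums are the iterates themselves, as the iteration starts at
    0.\<close>
  then have lim: "?Y \<longlonglongrightarrow> Y"
    by (simp only: sums_def sum_lessThan_telescope) simp
  have limv: "(\<lambda>n. ?Y n v) \<longlonglongrightarrow> Y v" for v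
    by (intro tendsto_intros lim)
  show thesis
  proof
    show "norm Y \<le> 1"
    proof (rule Lim_bounded[OF tendsto_norm[OF lim]])
      show "\<forall>n\<ge>0. norm (?Y n) \<le> 1"
        using norm_sqrt_iterate[OF X] scalar_iterate_bounds(2) order_trans by blast
    qed
    show "2 *\<^sub>R Y v = X v + Y (Y v)" for v
    proof (rule LIMSEQ_unique)
      show "(\<lambda>n. 2 *\<^sub>R ?Y (Suc n) v) \<longlonglongrightarrow> 2 *\<^sub>R Y v"
        by (intro tendsto_intros LIMSEQ_Suc[OF lim])
      have "(\<lambda>n. X v + ?Y n (?Y n v)) \<longlonglongrightarrow> X v + Y (Y v)"
        by (intro tendsto_intros lim)
      then show "(\<lambda>n. 2 *\<^sub>R ?Y (Suc n) v) \<longlonglongrightarrow> X v + Y (Y v)"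
        by (simp add: blinfun.bilinear_simps)
    qed
    fix B v
    assume B: "bounded_linear B" and BX: "\<And>u. B (X u) = X (B u)"
    show "B (Y v) = Y (B v)"
    proof (rule LIMSEQ_unique)
      show "(\<lambda>n. B (?Y n v)) \<longlonglongrightarrow> B (Y v)"
        by (rule bounded_linear.tendsto[OF B limv])
      show "(\<lambda>n. B (?Y n v)) \<longlonglongrightarrow> Y (B v)"
        using limv[of "B v"] by (simp add: sqrt_iterate_commute[OF B BX])
    qed
  qed
qed

text \<open>With \<open>A = N - e\<close> and \<open>Q = |A| + A\<close> one has
  \<open>Q A = Q |A|\<close>, hence \<open>Q N = Q (|A| + e)\<close>, where \<open>|A| + e\<close>
  is onto. For the zero set of \<open>Q\<close> after an affine map with linear part
  \<open>N\<close>, the three conclusions serve to show invariance, non-emptiness and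
  properness.\<close>

lemma positive_part_exists:
  fixes N :: "'a::{real_inner, banach} \<Rightarrow>\<^sub>L 'a"
  assumes sym: "\<And>u v. inner (N u) v = inner u (N v)"
    and N: "norm N \<le> 1/2" and e: "0 < e" "e \<le> 1/2"
    and large: "\<not> (\<forall>v. inner (N v) v \<le> e * (norm v)\<^sup>2)"
  obtains Q :: "'a \<Rightarrow>\<^sub>L 'a"
  where "\<And>B v. bounded_linear B \<Longrightarrow> (\<And>u. B (N u) = N (B u)) \<Longrightarrow> B (Q v) = Q (B v)"
    and "\<And>w. \<exists>v. Q (N v + w) = 0"
    and "\<exists>v. Q (N v) \<noteq> 0"
proof -
  define A where "A = N - e *\<^sub>R id_blinfun"
  have A: "A v = N v - e *\<^sub>R v" for v
    by (simp add: A_def blinfun.bilinear_simps)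
  \<comment> \<open>The bounds 1/2 on \<open>N\<close> and on \<open>e\<close> give \<open>A\<close>
    norm at most 1, which the bound on \<open>X\<close> needs.\<close>
  have normA: "norm (A v) \<le> norm v" for v
  proof -
    have "norm (A v) \<le> norm (N v) + norm (e *\<^sub>R v)"
      unfolding A by (rule norm_triangle_ineq4)
    also have "\<dots> \<le> (1/2) * norm v + (1/2) * norm v"
      using e mult_right_mono[OF e(2), of "norm v"]
      by (intro add_mono order_trans[OF norm_blinfun] mult_right_mono N) auto
    finally show ?thesis by simp
  qed
  have symA: "inner (A u) v = inner u (A v)" for u v
    by (simp add: A inner_simps sym)
  \<comment> \<open>Chosen so that \<open>1 - X = A^2\<close>, whose square root is the absolute
    value of \<open>A\<close>.\<close>
  define X where "X = id_blinfun - (A o\<^sub>L A)"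
  have X: "X v = v - A (A v)" for v
    by (simp add: X_def blinfun.bilinear_simps)
  have "norm X \<le> 1"
  proof (rule norm_blinfun_bound)
    fix v
    have "(norm (X v))\<^sup>2 = (norm v)\<^sup>2 - 2 * (norm (A v))\<^sup>2 + (norm (A (A v)))\<^sup>2"
      by (simp add: X power2_norm_eq_inner inner_simps symA[of "A v" v, symmetric] inner_commute)
    also have "\<dots> \<le> (norm v)\<^sup>2"
      using power_mono[OF normA[of "A v"] norm_ge_zero, of 2] zero_le_power2[of "norm (A v)"] by linarith
    finally show "norm (X v) \<le> 1 * norm v"
      by (simp add: power2_le_iff_abs_le)
  qed simp
  then obtain Y :: "'a \<Rightarrow>\<^sub>L 'a" where Y: "norm Y \<le> 1" "\<And>v. 2 *\<^sub>R Y v = X v + Y (Y v)"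
    and Ycomm: "\<And>B v. bounded_linear B \<Longrightarrow> (\<And>u. B (X u) = X (B u)) \<Longrightarrow> B (Y v) = Y (B v)"
    by (rule one_minus_sqrt_exists) blast
  have normY: "norm (Y v) \<le> norm v" for v
    using norm_blinfun[of Y v] mult_right_mono[OF Y(1), of "norm v"] by simp
  have AY: "A (Y v) = Y (A v)" for v
    by (rule Ycomm) (simp_all add: X blinfun.bounded_linear_right blinfun.bilinear_simps)
  \<comment> \<open>\<open>S = 1 - Y\<close> is the absolute value of \<open>A\<close>, so \<open>Q\<close> is twice the positive part of \<open>A\<close>.\<close>
  define S where "S = id_blinfun - Y"
  have S: "S v = v - Y v" for v
    by (simp add: S_def blinfun.bilinear_simps)
  have SS: "S (S v) = A (A v)" for v
  proof -
    have "S (S v) = v - (2 *\<^sub>R Y v - Y (Y v))"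
      by (simp add: S blinfun.bilinear_simps scaleR_2)
    then show ?thesis
      unfolding Y(2) X by simp
  qed
  have AS: "A (S v) = S (A v)" for v
    by (simp add: S blinfun.bilinear_simps AY)
  define Q where "Q = S + A"
  have Q: "Q v = S v + A v" for v
    by (simp add: Q_def blinfun.bilinear_simps)
  \<comment> \<open>\<open>S + e\<close> is invertible and agrees with \<open>N\<close> on the range of \<open>Q\<close>.\<close>
  have QN: "Q (N v) = Q (S v + e *\<^sub>R v)" for v
  proof -
    have "N v = A v + e *\<^sub>R v"
      by (simp add: A)
    moreover have "Q (A v) = Q (S v)"
      by (simp add: Q AS SS)
    ultimately show ?thesis
      by (simp add: blinfun.bilinear_simps)
  qed
  have surj: "\<exists>v. S v + e *\<^sub>R v = w" for w
  proof -
    \<comment> \<open>A fixed point of \<open>f\<close> satisfies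
      \<open>(1 + e) v = Y v + w\<close>, which is the equation to solve. As \<open>Y\<close> has
      norm at most 1, \<open>f\<close> contracts by the factor
      \<open>1 / (1 + e) < 1\<close>.\<close>
    define f where "f v = (1 / (1 + e)) *\<^sub>R (Y v + w)" for v
    have "dist (f u) (f v) \<le> (1 / (1 + e)) * dist u v" for u v
    proof -
      have "f u - f v = (1 / (1 + e)) *\<^sub>R Y (u - v)"
        by (simp add: f_def blinfun.bilinear_simps scaleR_diff_right scaleR_add_right)
      then show ?thesis
        using e normY[of "u - v"] by (simp add: dist_norm divide_right_mono)
    qed
    then have "\<exists>!v. f v = v"
      using e by (intro banach_fix_type[where c = "1 / (1 + e)"]) auto
    then obtain v where v: "f v = v" by blast
    have "(1 + e) *\<^sub>R f v = Y v + w"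
      using e by (simp add: f_def)
    then have "S v + e *\<^sub>R v = w"
      unfolding v by (simp add: S scaleR_add_left algebra_simps)
    then show ?thesis ..
  qed
  show thesis
  proof
    fix B v
    assume B: "bounded_linear B" and BN: "\<And>u. B (N u) = N (B u)"
    interpret B: bounded_linear B by (fact B)
    have BA: "B (A u) = A (B u)" for u
      by (simp add: A B.diff B.scaleR BN)
    have "B (Y v) = Y (B v)"
      by (rule Ycomm[OF B]) (simp add: X B.diff BA)
    then show "B (Q v) = Q (B v)"
      by (simp add: Q S B.add B.diff BA)
  next
    fix w
    obtain v where "S v + e *\<^sub>R v = - w"
      using surj by blast
    then show "\<exists>v. Q (N v + w) = 0"
      by (intro exI[of _ v]) (simp add: blinfun.add_right QN blinfun.minus_right)
  next
    show "\<exists>v. Q (N v) \<noteq> 0"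
    proof (rule ccontr)
      assume "\<not> ?thesis"
      then have Q0: "Q w = 0" for w
        using QN surj[of w] by metis
      \<comment> \<open>From \<open>Q = 0\<close> follows \<open>N = e - S\<close>, and
        \<open>S\<close> is positive because \<open>Y\<close> has norm at most 1.\<close>
      have "inner (N v) v \<le> e * (norm v)\<^sup>2" for v
      proof -
        have "inner (Y v) v \<le> (norm v)\<^sup>2"
          using norm_cauchy_schwarz[of "Y v" v] mult_right_mono[OF normY[of v], of "norm v"]
          by (simp add: power2_eq_square)
        moreover have "N v = e *\<^sub>R v - S v"
          using Q0[of v] by (simp add: Q A algebra_simps)
        ultimately show ?thesis
          by (simp add: S inner_simps power2_norm_eq_inner)
      qed
      with large show False by blast
    qed
  qed
qed

section \<open>Complex Hilbert spaces and unitary operators\<close>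

subclass (in chilbert_space) banach ..

lemma norm_scaleC: "norm (c *\<^sub>C x) = cmod c * norm x"
  for x :: "'a::complex_inner"
proof -
  have "cinner (c *\<^sub>C x) (c *\<^sub>C x) = c * cnj c * cnj (cinner x x)"
    by (simp add: cinner_scaleC_left cinner_commute[of x "c *\<^sub>C x"])
  also have "\<dots> = complex_of_real ((cmod c)\<^sup>2 * (norm x)\<^sup>2)"
    by (simp only: cinner_self complex_norm_square complex_cnj_complex_of_real of_real_mult)
  finally have "(norm (c *\<^sub>C x))\<^sup>2 = (cmod c * norm x)\<^sup>2"
    unfolding cinner_self of_real_eq_iff power_mult_distrib .
  then show ?thesis
    by (rule power2_eq_imp_eq) auto
qed

lemma scaleC_scaleR: "c *\<^sub>C (r *\<^sub>R x) = r *\<^sub>R (c *\<^sub>C x)"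
  by (simp add: scaleC_of_real[symmetric] scaleC_scaleC mult.commute)

lemma bounded_linear_scaleC_right: "bounded_linear (\<lambda>x::'a::complex_inner. c *\<^sub>C x)"
  by (rule bounded_linear_intro[where K = "cmod c"])
    (simp_all add: scaleC_add_right scaleC_scaleR norm_scaleC)

lemma unitary_scaleC: "unitary U \<Longrightarrow> U (c *\<^sub>C x) = c *\<^sub>C U x"
  by (simp add: unitary_def Vector_Spaces.linear_iff)

lemma unitary_add: "unitary U \<Longrightarrow> U (x + y) = U x + U y"
  by (simp add: unitary_def Vector_Spaces.linear_iff)

lemma unitary_inner: "unitary U \<Longrightarrow> inner (U x) (U y) = inner x y"
  by (simp add: unitary_def flip: Re_cinner)

lemma unitary_bounded_linear:
  assumes "unitary U"
  shows "bounded_linear U"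
proof (rule bounded_linear_intro[where K = 1])
  show "U (r *\<^sub>R x) = r *\<^sub>R U x" for r x
    unfolding scaleC_of_real[symmetric] by (rule unitary_scaleC[OF assms])
  show "norm (U x) \<le> norm x * 1" for x
    by (simp add: norm_eq_sqrt_inner unitary_inner[OF assms])
qed (rule unitary_add[OF assms])

section \<open>The linear part of an irreducible action\<close>

text \<open>Allows sums over a conjugacy class to be reindexed by conjugation, the source of the
  equivariance of \<open>D\<close>.\<close>

lemma bij_betw_conjugacy_class:
  fixes g h :: "'g::group_add"
  shows "bij_betw (\<lambda>c. - h + c + h) {k + g - k | k. True} {k + g - k | k. True}"
proof (rule bij_betw_byWitness[where f' = "\<lambda>c. h + c - h"])
  have "- h + (k + g - k) + h = (- h + k) + g - (- h + k)" for k
    by (simp only: diff_conv_add_uminus minus_add minus_minus add.assoc)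
  then show "(\<lambda>c. - h + c + h) ` {k + g - k | k. True} \<subseteq> {k + g - k | k. True}"
    by blast
  have "h + (k + g - k) - h = (h + k) + g - (h + k)" for k
    by (simp only: diff_conv_add_uminus minus_add minus_minus add.assoc)
  then show "(\<lambda>c. h + c - h) ` {k + g - k | k. True} \<subseteq> {k + g - k | k. True}"
    by blast
qed (simp_all add: algebra_simps)

lemma irreducible_FC_linear_part_trivial:
  fixes \<alpha> \<pi> :: "'g::topological_group_add \<Rightarrow> 'h::chilbert_space \<Rightarrow> 'h"
  assumes FC: "FC_group TYPE('g)" and irr: "irreducible_action \<alpha>"
    and rep: "unitary_representation \<pi>"
    and cocycle: "\<And>g h. b (g + h) = b g + \<pi> g (b h)"
    and \<alpha>: "\<And>g v. \<alpha> g v = \<pi> g v + b g"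
  shows "\<pi> g v = v"
proof -
  have U: "unitary (\<pi> g)" and \<pi>0: "\<pi> 0 v = v" and \<pi>_plus: "\<pi> (g + h) v = \<pi> g (\<pi> h v)" for g h v
    using rep by (auto simp: unitary_representation_def)
  have \<pi>_bl: "bounded_linear (\<pi> g)" for g
    by (rule unitary_bounded_linear[OF U])
  note \<pi>_simps = linear_add[OF bounded_linear.linear[OF \<pi>_bl]]
    linear_diff[OF bounded_linear.linear[OF \<pi>_bl]] linear_scale[OF bounded_linear.linear[OF \<pi>_bl]]
    linear_sum[OF bounded_linear.linear[OF \<pi>_bl]]
  have \<pi>_norm: "norm (\<pi> g v) = norm v" for g v
    by (simp add: norm_eq_sqrt_inner unitary_inner[OF U])
  have \<pi>_adj: "inner (\<pi> g u) v = inner u (\<pi> (- g) v)" for g u v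
    using unitary_inner[OF U, of g u "\<pi> (- g) v"] by (simp flip: \<pi>_plus add: \<pi>0)
  have \<alpha>_plus: "\<alpha> (g + h) v = \<alpha> g (\<alpha> h v)" for g h v
    by (simp add: \<alpha> cocycle \<pi>_plus \<pi>_simps)
  have \<alpha>_diff: "\<alpha> g u - \<alpha> g v = \<pi> g (u - v)" for g u v
    by (simp add: \<alpha> \<pi>_simps)

  \<comment> \<open>The normalized displacement over a conjugacy class\<close>
  define C where "C = {k + g - k | k. True}"
  have "finite C"
    using FC by (simp add: C_def FC_group_def)
  have "g \<in> C"
    unfolding C_def by (rule CollectI, rule exI[of _ 0]) simp
  have reindex: "(\<Sum>c\<in>C. f (- h + c + h)) = (\<Sum>c\<in>C. f c)" for f :: "'g \<Rightarrow> 'h" and h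
    using bij_betw_conjugacy_class unfolding C_def by (rule sum.reindex_bij_betw)
  \<comment> \<open>Each summand of \<open>N'\<close> has norm at most \<open>4 * norm v\<close>, so
    this factor yields the bound 1/2 on \<open>N\<close> required for the positive part.\<close>
  define \<kappa> :: real where "\<kappa> = 1 / (8 * card C)"
  have card: "card C > 0"
    using \<open>finite C\<close> \<open>g \<in> C\<close> card_gt_0_iff by blast
  then have \<kappa>: "\<kappa> > 0" by (simp add: \<kappa>_def)
  \<comment> \<open>Pairing \<open>c\<close> with \<open>- c\<close> makes the linear part
    self-adjoint, as \<open>\<pi> (- c)\<close> is the adjoint of \<open>\<pi> c\<close>.\<close>
  define D where "D v = \<kappa> *\<^sub>R (\<Sum>c\<in>C. (v - \<alpha> c v) + (v - \<alpha> (- c) v))" for v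
  define N' where "N' v = \<kappa> *\<^sub>R (\<Sum>c\<in>C. (v - \<pi> c v) + (v - \<pi> (- c) v))" for v

  have "bounded_linear N'"
    unfolding N'_def
    by (intro bounded_linear_const_scaleR bounded_linear_sum bounded_linear_add bounded_linear_sub
        bounded_linear_ident \<pi>_bl)
  then obtain N :: "'h \<Rightarrow>\<^sub>L 'h" where N: "N v = N' v" for v
    by (metis bounded_linear_Blinfun_apply)
  have D_N: "D v = N v + D 0" for v
  proof -
    have "\<alpha> c v = \<pi> c v + \<alpha> c 0" for c
      using \<alpha>_diff[of c v 0] by (simp add: algebra_simps)
    then have "v - \<alpha> c v = (v - \<pi> c v) + (0 - \<alpha> c 0)" for c
      by simp
    then have "(v - \<alpha> c v) + (v - \<alpha> (- c) v) =
        ((v - \<pi> c v) + (v - \<pi> (- c) v)) + ((0 - \<alpha> c 0) + (0 - \<alpha> (- c) 0))" for c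
      by (metis add.assoc add.left_commute)
    then show ?thesis
      unfolding N N'_def D_def by (simp only: sum.distrib scaleR_add_right)
  qed
  have D_equivariant: "D (\<alpha> h v) = \<pi> h (D v)" for h v
  proof -
    \<comment> \<open>Moving \<open>\<alpha> h\<close> to the left past \<open>\<alpha> c\<close>
      conjugates \<open>c\<close>, and the sum over \<open>C\<close> absorbs this.\<close>
    have *: "\<alpha> h v - \<alpha> c (\<alpha> h v) = \<pi> h (v - \<alpha> (- h + c + h) v)" for c
      unfolding \<alpha>_diff[symmetric] \<alpha>_plus[symmetric] by (simp add: add.assoc[symmetric])
    have **: "- h + - c + h = - (- h + c + h)" for c
      by (simp add: minus_add add.assoc)
    have "D (\<alpha> h v) = \<pi> h (\<kappa> *\<^sub>R (\<Sum>c\<in>C. (v - \<alpha> (- h + c + h) v) + (v - \<alpha> (- (- h + c + h)) v)))"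
      by (simp only: D_def * ** \<pi>_simps)
    then show ?thesis
      unfolding D_def using reindex[of "\<lambda>c. (v - \<alpha> c v) + (v - \<alpha> (- c) v)"] by simp
  qed
  have N_\<pi>: "\<pi> h (N v) = N (\<pi> h v)" for h v
  proof -
    have "\<pi> h (N v) = \<pi> h (D v - D 0)"
      by (simp add: D_N[of v])
    also have "\<dots> = D (\<alpha> h v) - D (\<alpha> h 0)"
      by (simp add: D_equivariant \<pi>_simps)
    also have "\<dots> = N (\<alpha> h v - \<alpha> h 0)"
      by (simp only: D_N[of "\<alpha> h v"] D_N[of "\<alpha> h 0"] blinfun.diff_right add_diff_cancel_right)
    finally show ?thesis
      by (simp add: \<alpha>_diff)
  qed
  \<comment> \<open>The positive part is built over the reals; this commutation makes
    \<open>Q\<close> complex linear and hence \<open>V\<close> complex affine.\<close>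
  have N_scaleC: "c *\<^sub>C N v = N (c *\<^sub>C v)" for c v
  proof -
    have lin: "linear (\<lambda>x::'h. c *\<^sub>C x)"
      by (rule bounded_linear_scaleC_right[THEN bounded_linear.linear])
    show ?thesis
      by (simp only: N N'_def unitary_scaleC[OF U] linear_sum[OF lin] linear_add[OF lin]
          linear_diff[OF lin] scaleC_scaleR)
  qed
  have N_sym: "inner (N u) v = inner u (N v)" for u v
    by (simp add: N N'_def inner_simps inner_sum_left inner_sum_right \<pi>_adj)
      (simp add: algebra_simps)
  have N_norm: "norm N \<le> 1/2"
  proof (rule norm_blinfun_bound)
    fix v
    have "norm (N v) = \<kappa> * norm (\<Sum>c\<in>C. (v - \<pi> c v) + (v - \<pi> (- c) v))"
      using \<kappa> by (simp add: N N'_def)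
    also have "\<dots> \<le> \<kappa> * (\<Sum>c\<in>C. 4 * norm v)"
    proof (intro mult_left_mono sum_norm_le)
      fix c
      show "norm ((v - \<pi> c v) + (v - \<pi> (- c) v)) \<le> 4 * norm v"
        using norm_triangle_ineq[of "v - \<pi> c v" "v - \<pi> (- c) v"]
          norm_triangle_ineq4[of v "\<pi> c v"] norm_triangle_ineq4[of v "\<pi> (- c) v"]
        by (simp add: \<pi>_norm)
    qed (use \<kappa> in simp)
    also have "\<dots> = 1/2 * norm v"
      using card by (simp add: \<kappa>_def)
    finally show "norm (N v) \<le> 1/2 * norm v" .
  qed simp

  \<comment> \<open>The spectral bound forced by irreducibility\<close>
  have small: "inner (N v) v \<le> e * (norm v)\<^sup>2" if e: "0 < e" "e \<le> 1/2" for e v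
  proof (rule ccontr)
    assume "\<not> ?thesis"
    then have "\<not> (\<forall>v. inner (N v) v \<le> e * (norm v)\<^sup>2)" by blast
    from positive_part_exists[OF N_sym N_norm e this] obtain Q :: "'h \<Rightarrow>\<^sub>L 'h" where
      comm: "\<And>B v. bounded_linear B \<Longrightarrow> (\<And>u. B (N u) = N (B u)) \<Longrightarrow> B (Q v) = Q (B v)"
      and ex0: "\<And>w. \<exists>v. Q (N v + w) = 0" and ex1: "\<exists>v. Q (N v) \<noteq> 0"
      by blast
    have Q_\<pi>: "\<pi> h (Q v) = Q (\<pi> h v)" for h v
      by (rule comm[OF \<pi>_bl N_\<pi>])
    have Q_scaleC: "c *\<^sub>C Q v = Q (c *\<^sub>C v)" for c v
      by (rule comm[OF bounded_linear_scaleC_right N_scaleC])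
    define V where "V = {v. Q (D v) = 0}"
    have V: "v \<in> V \<longleftrightarrow> Q (N v + D 0) = 0" for v
      by (simp add: V_def D_N[of v])
    have "V \<noteq> {}"
      using ex0 V by blast
    moreover have "V \<noteq> UNIV"
    proof
      assume "V = UNIV"
      then have "Q (N v + D 0) = 0" for v
        using V by blast
      \<comment> \<open>At 0 the identity reads \<open>Q (D 0) = 0\<close>; subtracting it leaves
        \<open>Q N = 0\<close>.\<close>
      from this this[of 0] have "Q (N v) = 0" for v
        by (simp add: blinfun.add_right)
      with ex1 show False by blast
    qed
    moreover have "closed V"
    proof -
      have "V = {v. Q (N v + D 0) = 0}"
        using V by blast
      also have "closed \<dots>"
        by (intro closed_Collect_eq continuous_intros)
      finally show ?thesis .
    qed
    moreover have "complex_affine V"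
      unfolding complex_affine_def
    proof (intro ballI allI impI)
      fix x y and c d :: complex
      assume xy: "x \<in> V" "y \<in> V" and cd: "c + d = 1"
      have "D 0 = c *\<^sub>C D 0 + d *\<^sub>C D 0"
        using cd by (simp flip: scaleC_add_left)
      then have "N (c *\<^sub>C x + d *\<^sub>C y) + D 0 = c *\<^sub>C (N x + D 0) + d *\<^sub>C (N y + D 0)"
        by (simp add: blinfun.add_right scaleC_add_right flip: N_scaleC)
      then have "Q (N (c *\<^sub>C x + d *\<^sub>C y) + D 0) = c *\<^sub>C Q (N x + D 0) + d *\<^sub>C Q (N y + D 0)"
        by (simp only: blinfun.add_right[of Q "c *\<^sub>C _"] Q_scaleC)
      also have "\<dots> = 0"
        using xy by (simp add: V)
      finally show "c *\<^sub>C x + d *\<^sub>C y \<in> V"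
        by (simp add: V)
    qed
    moreover have "\<alpha> h ` V \<subseteq> V" for h
      using linear_0[OF bounded_linear.linear[OF \<pi>_bl]]
      by (auto simp: V_def D_equivariant simp flip: Q_\<pi>)
    ultimately show False
      using irr unfolding irreducible_action_def by blast
  qed

  \<comment> \<open>Vanishing of the quadratic form of \<open>N\<close>\<close>
  have "inner (N v) v \<le> 0"
  proof (rule field_le_epsilon)
    fix e :: real
    assume e: "e > 0"
    \<comment> \<open>The cap 1/2 is the range of \<open>small\<close>; the other term gives
      \<open>d * (norm v)\<^sup>2 \<le> e\<close>, with \<open>+ 1\<close> keeping the denominator
      positive at \<open>v = 0\<close>.\<close>
    define d where "d = min (1/2) (e / ((norm v)\<^sup>2 + 1))"
    have pos: "(norm v)\<^sup>2 + 1 > 0"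
      by (rule add_nonneg_pos) simp_all
    have "d \<le> 1/2" "d \<le> e / ((norm v)\<^sup>2 + 1)"
      unfolding d_def by (rule min.cobounded1 min.cobounded2)+
    moreover have "0 < d"
      using e pos by (simp add: d_def)
    ultimately have "inner (N v) v \<le> e / ((norm v)\<^sup>2 + 1) * (norm v)\<^sup>2"
      using small[of d v] mult_right_mono[of d _ "(norm v)\<^sup>2"] by fastforce
    also have "\<dots> \<le> e"
      using e pos by (simp add: field_simps)
    finally show "inner (N v) v \<le> 0 + e" by simp
  qed
  \<comment> \<open>The terms for \<open>c\<close> and \<open>- c\<close> have equal inner product
    with \<open>v\<close>, so each pair adds up to a square, and a nonpositive sum of squares
    vanishes termwise.\<close>
  moreover have "inner (N v) v = \<kappa> * (\<Sum>c\<in>C. (norm (v - \<pi> c v))\<^sup>2)"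
  proof -
    have "inner ((v - \<pi> c v) + (v - \<pi> (- c) v)) v = (norm (v - \<pi> c v))\<^sup>2" for c
      using \<pi>_adj[of "- c" v v]
      by (simp add: power2_norm_eq_inner inner_simps unitary_inner[OF U] inner_commute)
    then show ?thesis
      by (simp add: N N'_def inner_sum_left)
  qed
  ultimately have "(\<Sum>c\<in>C. (norm (v - \<pi> c v))\<^sup>2) \<le> 0"
    using \<kappa> by (simp add: mult_le_0_iff)
  moreover have "(norm (v - \<pi> g v))\<^sup>2 \<le> (\<Sum>c\<in>C. (norm (v - \<pi> c v))\<^sup>2)"
    using \<open>g \<in> C\<close> \<open>finite C\<close> by (intro member_le_sum) auto
  ultimately have "(norm (v - \<pi> g v))\<^sup>2 \<le> 0"
    by linarith
  then show ?thesis by simp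
qed

section \<open>Density of the span of the cocycle\<close>

theorem proposition4p8:
  fixes \<alpha> :: "'g::topological_group_add \<Rightarrow> 'h::chilbert_space \<Rightarrow> 'h"
  assumes "FC_group TYPE('g)"
    and "affine_isometric_action \<alpha>"
    and "irreducible_action \<alpha>"
  shows "\<exists>b :: 'g \<Rightarrow> 'h. continuous_on UNIV b \<and> (\<forall>g h. b (g + h) = b g + b h) \<and>
    (\<forall>g v. \<alpha> g v = v + b g) \<and> closure (cspan (range b)) = UNIV"
proof -
  obtain \<pi> b where rep: "unitary_representation \<pi>" and cont: "continuous_on UNIV b"
    and cocycle: "\<And>g h. b (g + h) = b g + \<pi> g (b h)" and \<alpha>: "\<And>g v. \<alpha> g v = \<pi> g v + b g"
    using assms(2) unfolding affine_isometric_action_def by blast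
  have \<pi>: "\<pi> g v = v" for g v
    by (rule irreducible_FC_linear_part_trivial[OF assms(1,3) rep cocycle \<alpha>])
  let ?S = "closure (cspan (range b))"
  \<comment> \<open>By continuity of the operations the closure of the span is a complex subspace,
    hence complex affine and stable under translation by each \<open>b g\<close>.\<close>
  have scaleC_S: "c *\<^sub>C x \<in> ?S" if "x \<in> ?S" for c x
  proof -
    have "(\<lambda>x. c *\<^sub>C x) ` ?S \<subseteq> closure ((\<lambda>x. c *\<^sub>C x) ` cspan (range b))"
      by (rule closure_bounded_linear_image_subset[OF bounded_linear_scaleC_right])
    also have "\<dots> \<subseteq> ?S"
      by (intro closure_mono) (auto intro: complex_vector.span_scale)
    finally show ?thesis using that by blast
  qed
  have add_S: "x + y \<in> ?S" if "x \<in> ?S" "y \<in> ?S" for x y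
  proof -
    obtain X Y where "\<forall>n. X n \<in> cspan (range b)" "X \<longlonglongrightarrow> x" "\<forall>n. Y n \<in> cspan (range b)" "Y \<longlonglongrightarrow> y"
      using \<open>x \<in> ?S\<close> \<open>y \<in> ?S\<close> unfolding closure_sequential by blast
    then have "\<forall>n. X n + Y n \<in> cspan (range b)" "(\<lambda>n. X n + Y n) \<longlonglongrightarrow> x + y"
      by (auto intro: complex_vector.span_add tendsto_add)
    then show ?thesis
      unfolding closure_sequential by (intro exI[of _ "\<lambda>n. X n + Y n"] conjI)
  qed
  have b_S: "b g \<in> ?S" for g
    using closure_subset complex_vector.span_base[of "b g" "range b"] by blast
  have "complex_affine ?S"
    by (simp add: complex_affine_def scaleC_S add_S)
  moreover have "\<alpha> g ` ?S \<subseteq> ?S" for g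
    by (auto simp: \<alpha> \<pi> intro: add_S b_S)
  ultimately have "?S = UNIV"
    using assms(3) b_S unfolding irreducible_action_def by (metis closed_closure empty_iff)
  with cont cocycle \<alpha> \<pi> show ?thesis by (intro exI[of _ b]) simp
qed

end
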